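(* Let $X$ be the Dynkin diagram of a symmetrizable Kac-Moody algebra, $Y$ a subdiagram of $X$ and $d\ge 2$ an integer. Suppose that at least one of the following two conditions holds: (a) $d \mid \langle \alpha_j^\vee,\alpha_i\rangle$ for all $i\in Y$, $j\in X\setminus Y$; or (b) $d \mid \langle \alpha_i^\vee,\alpha_j\rangle$ for all $i\in Y$, $j\in X\setminus Y$. Let $\Sigma=\{\beta_i : 1\le i\le m\}$ be a multiset with $\beta_i\in W\cdot\Delta^{re}(Y)$ for all $i$. Then there exists a multiset $\overline{\Sigma}=\{\overline{\beta}_i : 1\le i\le m\}$ with $\overline{\beta}_i\in\Delta^{re}(Y)$ for all $i$ such that $$M(\Sigma)\equiv M(\overline{\Sigma}) \pmod d,$$ where the congruence is entrywise.
   Context: $X$ is identified with its set of vertices; $\alpha_i$ and $\alpha_i^\vee$ ($i\in X$) denote the simple roots and simple coroots of the Kac-Moody algebra with Dynkin diagram $X$, $\Delta(X)$ its set of roots, and $W$ its Weyl group. A subdiagram $Y$ of $X$ is the diagram induced on a subset of vertices. $\Delta(Y)$ is the set of roots of $Y$, identified with $\Delta(X)\cap\bigoplus_{i\in Y}\mathbb Z\alpha_i$; $\Delta^{re}(Y)$ is the set of real roots of $Y$, so that $W\cdot \Delta^{re}(Y)=\bigcup_{p\in Y}W\alpha_p$. For a real root $\alpha$, $\alpha^\vee$ denotes its coroot. For a multiset $\Sigma=\{\beta_i: 1\le i\le m\}$ of real roots, $M(\Sigma):=[\langle\beta_i^\vee,\beta_j\rangle]_{i,j=1}^m$. *)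

theory Defs
  imports
    Complex_Main
    "HOL-Algebra.Bij"
    "HOL-Algebra.Generated_Groups"
    "HOL-Number_Theory.Cong"
begin

text \<open>
  A Dynkin diagram is given by its finite vertex set \<open>X\<close> and its generalized Cartan matrix
  \<open>A i j = \<langle>\<alpha>\<^sub>i\<^sup>\<or>, \<alpha>\<^sub>j\<rangle>\<close>, of which only the entries with
  \<open>i, j \<in> X\<close> matter.  The subdiagram induced on \<open>Y \<subseteq> X\<close> is therefore given by \<open>Y\<close>
  together with the same \<open>A\<close>.
\<close>

definition generalized_cartan_matrix :: "'i set \<Rightarrow> ('i \<Rightarrow> 'i \<Rightarrow> int) \<Rightarrow> bool" where
  "generalized_cartan_matrix X A \<longleftrightarrow>
     finite X \<and>
     (\<forall>i\<in>X. A i i = 2) \<and>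
     (\<forall>i\<in>X. \<forall>j\<in>X. i \<noteq> j \<longrightarrow> A i j \<le> 0) \<and>
     (\<forall>i\<in>X. \<forall>j\<in>X. A i j = 0 \<longrightarrow> A j i = 0)"

definition symmetrizable :: "'i set \<Rightarrow> ('i \<Rightarrow> 'i \<Rightarrow> int) \<Rightarrow> bool" where
  "symmetrizable X A \<longleftrightarrow>
     (\<exists>(D :: 'i \<Rightarrow> real) (B :: 'i \<Rightarrow> 'i \<Rightarrow> real).
        (\<forall>i\<in>X. D i \<noteq> 0) \<and>
        (\<forall>i\<in>X. \<forall>j\<in>X. B i j = B j i) \<and>
        (\<forall>i\<in>X. \<forall>j\<in>X. real_of_int (A i j) = D i * B i j))"

text \<open>
  Elements of the root lattice \<open>\<Oplus>\<^sub>i \<int>\<alpha>\<^sub>i\<close> and of the coroot lattice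
  \<open>\<Oplus>\<^sub>i \<int>\<alpha>\<^sub>i\<^sup>\<or>\<close> are both represented by their coordinate functions
  \<open>'i \<Rightarrow> int\<close>, which vanish outside the diagram.  Extension by zero identifies the lattices
  of a subdiagram with sublattices of those of the whole diagram.
\<close>

definition simple_root :: "'i \<Rightarrow> 'i \<Rightarrow> int" where
  "simple_root i = (\<lambda>k. if k = i then 1 else 0)"

definition simple_coroot :: "'i \<Rightarrow> 'i \<Rightarrow> int" where
  "simple_coroot i = (\<lambda>k. if k = i then 1 else 0)"

definition pairing :: "'i set \<Rightarrow> ('i \<Rightarrow> 'i \<Rightarrow> int) \<Rightarrow> ('i \<Rightarrow> int) \<Rightarrow> ('i \<Rightarrow> int) \<Rightarrow> int" where
  "pairing X A h \<beta> = (\<Sum>i\<in>X. \<Sum>j\<in>X. h i * A i j * \<beta> j)"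

definition simple_refl :: "'i set \<Rightarrow> ('i \<Rightarrow> 'i \<Rightarrow> int) \<Rightarrow> 'i \<Rightarrow> ('i \<Rightarrow> int) \<Rightarrow> ('i \<Rightarrow> int)" where
  "simple_refl X A i \<beta> = (\<lambda>k. \<beta> k - pairing X A (simple_coroot i) \<beta> * simple_root i k)"

definition simple_corefl :: "'i set \<Rightarrow> ('i \<Rightarrow> 'i \<Rightarrow> int) \<Rightarrow> 'i \<Rightarrow> ('i \<Rightarrow> int) \<Rightarrow> ('i \<Rightarrow> int)" where
  "simple_corefl X A i h = (\<lambda>k. h k - pairing X A h (simple_root i) * simple_coroot i k)"

text \<open>
  An element \<open>w\<close> of the Weyl group is represented by the pair of its actions on the root lattice
  (\<open>fst w\<close>) and on the coroot lattice (\<open>snd w\<close>).  The second action is in general not determined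
  by the first through the pairing of the two lattices, since that pairing may be degenerate.
\<close>

definition weyl_group ::
  "'i set \<Rightarrow> ('i \<Rightarrow> 'i \<Rightarrow> int) \<Rightarrow> ((('i \<Rightarrow> int) \<Rightarrow> ('i \<Rightarrow> int)) \<times> (('i \<Rightarrow> int) \<Rightarrow> ('i \<Rightarrow> int))) set" where
  "weyl_group X A =
     generate (BijGroup UNIV \<times>\<times> BijGroup UNIV) ((\<lambda>i. (simple_refl X A i, simple_corefl X A i)) ` X)"

definition weyl_orbits :: "'i set \<Rightarrow> ('i \<Rightarrow> 'i \<Rightarrow> int) \<Rightarrow> ('i \<Rightarrow> int) set \<Rightarrow> ('i \<Rightarrow> int) set" where
  "weyl_orbits X A T = {fst w \<beta> |w \<beta>. w \<in> weyl_group X A \<and> \<beta> \<in> T}"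

definition real_roots :: "'i set \<Rightarrow> ('i \<Rightarrow> 'i \<Rightarrow> int) \<Rightarrow> ('i \<Rightarrow> int) set" where
  "real_roots X A = weyl_orbits X A (simple_root ` X)"

text \<open>
  The coroot of \<open>\<beta> = w\<alpha>\<^sub>i\<close> is \<open>w\<alpha>\<^sub>i\<^sup>\<or>\<close>; that it does not depend on the choice of
  \<open>w\<close> and \<open>i\<close> is lemma \<open>coroot_eqI\<close> below.
\<close>

definition coroot :: "'i set \<Rightarrow> ('i \<Rightarrow> 'i \<Rightarrow> int) \<Rightarrow> ('i \<Rightarrow> int) \<Rightarrow> ('i \<Rightarrow> int)" where
  "coroot X A \<beta> =
     (THE h. \<exists>w\<in>weyl_group X A. \<exists>i\<in>X. \<beta> = fst w (simple_root i) \<and> h = snd w (simple_coroot i))"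

definition pairing_matrix ::
  "'i set \<Rightarrow> ('i \<Rightarrow> 'i \<Rightarrow> int) \<Rightarrow> (nat \<Rightarrow> 'i \<Rightarrow> int) \<Rightarrow> nat \<Rightarrow> nat \<Rightarrow> int" where
  "pairing_matrix X A \<beta> i j = pairing X A (coroot X A (\<beta> i)) (\<beta> j)"


lemma pairing_simple_left:
  assumes "finite X" "i \<in> X"
  shows "pairing X A (simple_coroot i) \<beta> = (\<Sum>j\<in>X. A i j * \<beta> j)"
proof -
  have "pairing X A (simple_coroot i) \<beta> =
          (\<Sum>k\<in>X. if k = i then \<Sum>j\<in>X. A k j * \<beta> j else 0)"
    unfolding pairing_def simple_coroot_def by (intro sum.cong) auto
  then show ?thesis using assms by simp
qed

lemma pairing_simple_right:
  assumes "finite X" "j \<in> X"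
  shows "pairing X A h (simple_root j) = (\<Sum>i\<in>X. h i * A i j)"
  unfolding pairing_def
proof (intro sum.cong refl)
  fix i
  have "(\<Sum>k\<in>X. h i * A i k * simple_root j k) = (\<Sum>k\<in>X. if k = j then h i * A i k else 0)"
    unfolding simple_root_def by (intro sum.cong) auto
  then show "(\<Sum>k\<in>X. h i * A i k * simple_root j k) = h i * A i j" using assms by simp
qed

lemma pairing_simple:
  assumes "finite X" "i \<in> X" "j \<in> X"
  shows "pairing X A (simple_coroot i) (simple_root j) = A i j"
proof -
  have "(\<Sum>k\<in>X. simple_coroot i k * A k j) = (\<Sum>k\<in>X. if k = i then A k j else 0)"
    unfolding simple_coroot_def by (intro sum.cong) auto
  then show ?thesis using assms by (simp add: pairing_simple_right)
qed

context
  fixes X :: "'i set" and A :: "'i \<Rightarrow> 'i \<Rightarrow> int"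
  assumes gcm: "generalized_cartan_matrix X A"
begin

lemma finite_diagram: "finite X"
  using gcm by (simp add: generalized_cartan_matrix_def)

lemma pairing_self: "i \<in> X \<Longrightarrow> pairing X A (simple_coroot i) (simple_root i) = 2"
  using gcm by (simp add: pairing_simple finite_diagram generalized_cartan_matrix_def)

lemma pairing_diff_right:
  "pairing X A h (\<lambda>k. \<beta> k - c * \<gamma> k) = pairing X A h \<beta> - c * pairing X A h \<gamma>"
  unfolding pairing_def
  by (simp add: algebra_simps sum_subtractf sum_distrib_left)

lemma pairing_diff_left:
  "pairing X A (\<lambda>k. h k - c * g k) \<beta> = pairing X A h \<beta> - c * pairing X A g \<beta>"
  unfolding pairing_def
  by (simp add: algebra_simps sum_subtractf sum_distrib_left)

lemma simple_refl_invol: "i \<in> X \<Longrightarrow> simple_refl X A i (simple_refl X A i \<beta>) = \<beta>"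
  by (simp add: simple_refl_def pairing_diff_right pairing_self)

lemma simple_corefl_invol: "i \<in> X \<Longrightarrow> simple_corefl X A i (simple_corefl X A i h) = h"
  by (simp add: simple_corefl_def pairing_diff_left pairing_self)

lemma Bij_UNIV_iff: "f \<in> Bij (UNIV :: 'b set) \<longleftrightarrow> bij f"
  by (simp add: Bij_def)

lemma simple_refl_bij: "i \<in> X \<Longrightarrow> bij (simple_refl X A i)"
  using simple_refl_invol by (intro o_bij[of "simple_refl X A i"]) (auto simp: fun_eq_iff)

lemma simple_corefl_bij: "i \<in> X \<Longrightarrow> bij (simple_corefl X A i)"
  using simple_corefl_invol by (intro o_bij[of "simple_corefl X A i"]) (auto simp: fun_eq_iff)

lemma weyl_group_induct [consumes 1, case_names id refl comp]:
  assumes "w \<in> weyl_group X A"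
    and "P id id"
    and "\<And>i. i \<in> X \<Longrightarrow> P (simple_refl X A i) (simple_corefl X A i)"
    and "\<And>f g f' g'. P f g \<Longrightarrow> P f' g' \<Longrightarrow> P (f \<circ> f') (g \<circ> g')"
  shows "P (fst w) (snd w)"
proof -
  let ?B = "BijGroup (UNIV :: ('i \<Rightarrow> int) set)"
  let ?G = "?B \<times>\<times> ?B"
  have carr: "carrier ?B = {f. bij f}"
    by (auto simp: BijGroup_def Bij_UNIV_iff)
  have mult: "f \<otimes>\<^bsub>?B\<^esub> g = f \<circ> g" if "bij f" "bij g" for f g
    using that by (simp add: BijGroup_def Bij_UNIV_iff compose_def fun_eq_iff)
  have refl_inv: "inv\<^bsub>?G\<^esub> (simple_refl X A i, simple_corefl X A i) =
                    (simple_refl X A i, simple_corefl X A i)" if "i \<in> X" for i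
  proof (rule group.inv_equality)
    show "group ?G" by (intro DirProd_group group_BijGroup)
    show "(simple_refl X A i, simple_corefl X A i) \<otimes>\<^bsub>?G\<^esub> (simple_refl X A i, simple_corefl X A i) = \<one>\<^bsub>?G\<^esub>"
      using that
      by (simp add: mult simple_refl_bij simple_corefl_bij)
         (simp add: BijGroup_def fun_eq_iff simple_refl_invol simple_corefl_invol)
  qed (use that in \<open>auto simp: carr simple_refl_bij simple_corefl_bij\<close>)
  have "bij (fst w) \<and> bij (snd w) \<and> P (fst w) (snd w)"
    using assms(1) unfolding weyl_group_def
  proof (induction rule: generate.induct)
    case one
    have "(\<lambda>x::'i \<Rightarrow> int. x) = id" by auto
    then show ?case using assms(2) by (simp add: BijGroup_def restrict_def)
  next
    case (incl h)
    then show ?case using assms(3) by (auto simp: simple_refl_bij simple_corefl_bij)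
  next
    case (inv h)
    then show ?case using assms(3) by (auto simp: refl_inv simple_refl_bij simple_corefl_bij)
  next
    case (eng h1 h2)
    then have b: "bij (fst h1)" "bij (snd h1)" "bij (fst h2)" "bij (snd h2)"
      and P: "P (fst h1) (snd h1)" "P (fst h2) (snd h2)" by blast+
    have "h1 \<otimes>\<^bsub>?G\<^esub> h2 = (fst h1 \<circ> fst h2, snd h1 \<circ> snd h2)"
      by (simp only: mult_DirProd' mult[OF b(1,3)] mult[OF b(2,4)])
    then show ?case
      using assms(4)[OF P] bij_comp[OF b(3,1)] bij_comp[OF b(4,2)] by (simp only: fst_conv snd_conv)
  qed
  then show ?thesis by simp
qed

lemma coroot_unique:
  assumes sym: "symmetrizable X A"
    and w: "w \<in> weyl_group X A" and i: "i \<in> X"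
    and w': "w' \<in> weyl_group X A" and i': "i' \<in> X"
    and eq: "fst w (simple_root i) = fst w' (simple_root i')"
  shows "snd w (simple_coroot i) = snd w' (simple_coroot i')"
proof -
  obtain D0 B where D0: "\<forall>i\<in>X. D0 i \<noteq> (0::real)"
    and B: "\<forall>i\<in>X. \<forall>j\<in>X. B i j = (B j i :: real)"
    and AD0: "\<forall>i\<in>X. \<forall>j\<in>X. real_of_int (A i j) = D0 i * B i j"
    using sym unfolding symmetrizable_def by blast
  define D where "D k = (if k \<in> X then D0 k else 1)" for k
  have D: "D k \<noteq> 0" for k using D0 by (auto simp: D_def)
  have AD: "real_of_int (A i j) = D i * B i j" if "i \<in> X" "j \<in> X" for i j
    using AD0 that by (simp add: D_def)
  define form where "form \<beta> \<gamma> = (\<Sum>i\<in>X. \<Sum>j\<in>X. real_of_int (\<beta> i) * B i j * real_of_int (\<gamma> j))"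
    for \<beta> \<gamma> :: "'i \<Rightarrow> int"
  have form_sym: "form \<beta> \<gamma> = form \<gamma> \<beta>" for \<beta> \<gamma>
    unfolding form_def by (subst sum.swap) (auto intro!: sum.cong simp: B)
  have form_diff: "form (\<lambda>k. \<beta> k - c * \<delta> k) \<gamma> = form \<beta> \<gamma> - of_int c * form \<delta> \<gamma>" for \<beta> \<gamma> \<delta> c
    unfolding form_def by (simp add: algebra_simps sum_subtractf sum_distrib_left)
  have form_diff': "form \<gamma> (\<lambda>k. \<beta> k - c * \<delta> k) = form \<gamma> \<beta> - of_int c * form \<gamma> \<delta>" for \<beta> \<gamma> \<delta> c
    by (simp add: form_sym[of \<gamma> \<beta>] form_sym[of \<gamma> \<delta>]
          form_sym[of \<gamma> "\<lambda>k. \<beta> k - c * \<delta> k"] form_diff)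
  have pair_form: "real_of_int (pairing X A h \<beta>) = c * form \<gamma> \<beta>"
    if "\<And>k. D k * h k = c * \<gamma> k" for h \<beta> \<gamma> c
  proof -
    have "real_of_int (h k * A k j * \<beta> j) = c * (\<gamma> k * B k j * \<beta> j)"
      if "k \<in> X" "j \<in> X" for k j
      using \<open>\<And>k. D k * h k = c * \<gamma> k\<close>[of k] AD[OF that] by (simp add: mult_ac) 
    then show ?thesis
      unfolding pairing_def form_def of_int_sum sum_distrib_left by (intro sum.cong refl)
  qed
  have pair_form_simple: "real_of_int (pairing X A (simple_coroot j) \<beta>) = D j * form (simple_root j) \<beta>"
    for j \<beta>
    by (intro pair_form) (simp add: simple_coroot_def simple_root_def)
  have form_simple: "D j * form (simple_root j) (simple_root j) = 2" if "j \<in> X" for j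
    using pair_form_simple[of j "simple_root j"] pairing_self[OF that] by simp
  define P where "P f g \<longleftrightarrow>
      (\<forall>\<beta> h c. (\<forall>k. D k * real_of_int (h k) = c * real_of_int (\<beta> k)) \<longrightarrow>
               (\<forall>k. D k * real_of_int (g h k) = c * real_of_int (f \<beta> k))) \<and>
      (\<forall>\<beta>. form (f \<beta>) (f \<beta>) = form \<beta> \<beta>)" for f g :: "('i \<Rightarrow> int) \<Rightarrow> ('i \<Rightarrow> int)"
  have P_refl: "P (simple_refl X A i) (simple_corefl X A i)" if "i \<in> X" for i
  proof -
    have "form (simple_refl X A i \<beta>) (simple_refl X A i \<beta>) = form \<beta> \<beta>" for \<beta>
    proof -
      let ?p = "form (simple_root i) \<beta>"
      have "form (simple_refl X A i \<beta>) (simple_refl X A i \<beta>) =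
            form \<beta> \<beta> - 2 * D i * ?p\<^sup>2 + D i * ?p\<^sup>2 * (D i * form (simple_root i) (simple_root i))"
        unfolding simple_refl_def form_diff form_diff' pair_form_simple form_sym[of \<beta> "simple_root i"]
        by (simp add: algebra_simps power2_eq_square)
      then show ?thesis by (simp add: form_simple[OF that])
    qed
    moreover have "D k * real_of_int (simple_corefl X A i h k) = c * real_of_int (simple_refl X A i \<beta> k)"
      if h: "\<forall>k. D k * real_of_int (h k) = c * real_of_int (\<beta> k)" for \<beta> h c k
    proof -
      have "real_of_int (pairing X A h (simple_root i)) = c * form (simple_root i) \<beta>"
        using pair_form[of h c \<beta> "simple_root i"] h form_sym[of \<beta> "simple_root i"] by simp
      moreover have "simple_root i k = simple_coroot i k" "k = i \<or> simple_coroot i k = 0"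
        by (simp_all add: simple_root_def simple_coroot_def)
      moreover have "D k * real_of_int (h k) = c * real_of_int (\<beta> k)" using h ..
      ultimately show ?thesis
        by (auto simp: simple_corefl_def simple_refl_def pair_form_simple right_diff_distrib)
    qed
    ultimately show ?thesis unfolding P_def by blast
  qed
  have main: "P (fst w) (snd w)" if "w \<in> weyl_group X A" for w
    using that
  proof (rule weyl_group_induct)
    show "P id id" by (simp add: P_def)
    show "P (f \<circ> f') (g \<circ> g')" if "P f g" "P f' g'" for f g f' g'
      using that unfolding P_def o_apply by (intro conjI; metis)
  qed (rule P_refl)
  define \<beta> where "\<beta> = fst w (simple_root i)"
  have h: "\<forall>k. D k * real_of_int (snd v (simple_coroot j) k) = D j * real_of_int (fst v (simple_root j) k)"
    if "v \<in> weyl_group X A" for v j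
    using main[OF that] unfolding P_def by (simp add: simple_coroot_def simple_root_def)
  have f: "D j * form (fst v (simple_root j)) (fst v (simple_root j)) = 2"
    if "v \<in> weyl_group X A" "j \<in> X" for v j
    using main[OF that(1)] unfolding P_def using form_simple[OF that(2)] by simp
  have "D i * form \<beta> \<beta> = 2" "D i' * form \<beta> \<beta> = 2"
    using f[OF w i] f[OF w' i'] eq by (simp_all add: \<beta>_def)
  then have "D i = D i'"
    by (metis mult_cancel_right mult_zero_right zero_neq_numeral)
  then have "D k * real_of_int (snd w (simple_coroot i) k) = D k * real_of_int (snd w' (simple_coroot i') k)" for k
    using h[OF w, of i] h[OF w', of i'] eq by simp
  then show ?thesis using D by (auto simp: fun_eq_iff)
qed

lemma coroot_eqI:
  assumes "symmetrizable X A" "w \<in> weyl_group X A" "i \<in> X"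
  shows "coroot X A (fst w (simple_root i)) = snd w (simple_coroot i)"
  unfolding coroot_def
proof (rule the_equality)
  show "\<exists>w'\<in>weyl_group X A. \<exists>i'\<in>X. fst w (simple_root i) = fst w' (simple_root i') \<and>
          snd w (simple_coroot i) = snd w' (simple_coroot i')"
    using assms(2,3) by (intro bexI[of _ w] bexI[of _ i] conjI refl)
next
  fix h
  assume "\<exists>w'\<in>weyl_group X A. \<exists>i'\<in>X. fst w (simple_root i) = fst w' (simple_root i') \<and>
            h = snd w' (simple_coroot i')"
  then obtain w' i' where *: "w' \<in> weyl_group X A" "i' \<in> X"
      "fst w (simple_root i) = fst w' (simple_root i')" "h = snd w' (simple_coroot i')"
    by (elim bexE conjE)
  show "h = snd w (simple_coroot i)"
    unfolding *(4) by (rule coroot_unique[OF assms(1,2,3) *(1,2,3), symmetric])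
qed

end

end

theory Submission
  imports Defs
begin

text \<open>
  In case (a) the reflections \<open>s\<^sub>j\<close> with \<open>j \<notin> Y\<close> fix the root lattice of \<open>Y\<close> modulo \<open>d\<close>, and
  they change coroots only by multiples of \<open>\<alpha>\<^sub>j\<^sup>\<or>\<close>, which pair with that lattice to \<open>0\<close> modulo \<open>d\<close>.
  So deleting from a word of \<open>W\<close> all letters outside \<open>Y\<close> changes neither the roots \<open>w\<alpha>\<^sub>p\<close>,
  \<open>p \<in> Y\<close>, modulo \<open>d\<close>, nor the pairings of their coroots with them.  Case (b) is dual.
  Both are covered at once by comparing roots on a set \<open>U\<close> of coordinates and coroots on a
  set \<open>V\<close>, where \<open>(U, V) = (X, Y)\<close> in case (a) and \<open>(U, V) = (Y, X)\<close> in case (b).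
\<close>

section \<open>Root-coroot pairs along words of the Weyl group\<close>

lemma generalized_cartan_matrix_subset:
  "generalized_cartan_matrix X A \<Longrightarrow> Y \<subseteq> X \<Longrightarrow> generalized_cartan_matrix Y A"
  unfolding generalized_cartan_matrix_def by (meson finite_subset subsetD)

text \<open>Growing the word letter by letter lets one induction carry a root together with its
  coroot and drop letters. The seeds \<open>T\<close> are separate from \<open>X\<close> since
  simple roots of Y are moved both by W(Y) and by W.\<close>

inductive root_coroot_pair ::
  "'i set \<Rightarrow> ('i \<Rightarrow> 'i \<Rightarrow> int) \<Rightarrow> 'i set \<Rightarrow> ('i \<Rightarrow> int) \<Rightarrow> ('i \<Rightarrow> int) \<Rightarrow> bool"
  for X A T where
  simple: "p \<in> T \<Longrightarrow> root_coroot_pair X A T (simple_root p) (simple_coroot p)"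
| refl: "root_coroot_pair X A T \<beta> h \<Longrightarrow> i \<in> X \<Longrightarrow>
           root_coroot_pair X A T (simple_refl X A i \<beta>) (simple_corefl X A i h)"

lemma root_coroot_pair_weyl:
  assumes "generalized_cartan_matrix X A" "w \<in> weyl_group X A" "root_coroot_pair X A T \<beta> h"
  shows "root_coroot_pair X A T (fst w \<beta>) (snd w h)"
proof -
  \<comment> \<open>The induction composes two arbitrary group elements, so the invariant is
    preservation of all pairs.\<close>
  define P where "P f g \<longleftrightarrow>
    (\<forall>\<beta> h. root_coroot_pair X A T \<beta> h \<longrightarrow> root_coroot_pair X A T (f \<beta>) (g h))" for f g
  have "P (fst w) (snd w)"
    by (rule weyl_group_induct[OF assms(1,2)]) (auto simp: P_def intro: root_coroot_pair.refl)
  then show ?thesis using assms(3) by (simp add: P_def)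
qed

text \<open>\<open>BijGroup\<close> multiplies by composition only on bijections, so both components
  of \<open>w\<close> are first shown bijective.\<close>

lemma weyl_group_refl_comp:
  assumes "generalized_cartan_matrix X A" "w \<in> weyl_group X A" "i \<in> X"
  shows "(simple_refl X A i \<circ> fst w, simple_corefl X A i \<circ> snd w) \<in> weyl_group X A"
proof -
  let ?B = "BijGroup (UNIV :: ('a \<Rightarrow> int) set)"
  have mult: "f \<otimes>\<^bsub>?B\<^esub> g = f \<circ> g" if "bij f" "bij g" for f g
    using that by (simp add: BijGroup_def Bij_def compose_def fun_eq_iff)
  have "bij (fst w) \<and> bij (snd w)"
    by (rule weyl_group_induct[OF assms(1,2)])
      (blast intro: bij_id bij_comp simple_refl_bij[OF assms(1)] simple_corefl_bij[OF assms(1)])+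
  then have "(simple_refl X A i \<circ> fst w, simple_corefl X A i \<circ> snd w) =
      (simple_refl X A i, simple_corefl X A i) \<otimes>\<^bsub>?B \<times>\<times> ?B\<^esub> w"
    by (simp add: mult_DirProd' mult simple_refl_bij[OF assms(1,3)] simple_corefl_bij[OF assms(1,3)])
  then show ?thesis
    using assms(2,3) unfolding weyl_group_def by (auto intro: generate.eng generate.incl)
qed

lemma root_coroot_pairE:
  assumes "root_coroot_pair X A T \<beta> h" and gcm: "generalized_cartan_matrix X A"
  obtains w p where "w \<in> weyl_group X A" "p \<in> T"
    "\<beta> = fst w (simple_root p)" "h = snd w (simple_coroot p)"
proof -
  have "\<exists>w\<in>weyl_group X A. \<exists>p\<in>T. \<beta> = fst w (simple_root p) \<and> h = snd w (simple_coroot p)"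
    using assms(1)
  proof induction
    case (simple p)
    have "(\<lambda>x. x, \<lambda>x. x) \<in> weyl_group X A"
      using generate.one[of "BijGroup UNIV \<times>\<times> BijGroup UNIV"]
      unfolding weyl_group_def by (simp add: BijGroup_def restrict_def)
    then show ?case by (rule bexI[rotated]) (use simple in auto)
  next
    case (refl \<beta> h i)
    then obtain w p where w: "w \<in> weyl_group X A" and p: "p \<in> T"
      and eq: "\<beta> = fst w (simple_root p)" "h = snd w (simple_coroot p)" by blast
    show ?case
      by (rule bexI[OF _ weyl_group_refl_comp[OF gcm w \<open>i \<in> X\<close>]]) (use p eq in auto)
  qed
  then show thesis using that by blast
qed

lemma root_coroot_pair_support:
  assumes "root_coroot_pair X A T \<beta> h" "T \<subseteq> X" "k \<notin> X"
  shows "\<beta> k = 0 \<and> h k = 0"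
  using assms
  by induction
    (auto simp: simple_root_def simple_coroot_def simple_refl_def simple_corefl_def)

section \<open>Compatibility of Y with X\<close>

lemma pairing_subset:
  assumes "finite X" "Y \<subseteq> X" "\<And>k. k \<notin> Y \<Longrightarrow> h k = 0" "\<And>k. k \<notin> Y \<Longrightarrow> \<beta> k = 0"
  shows "pairing X A h \<beta> = pairing Y A h \<beta>"
proof -
  have "(\<Sum>j\<in>X. h i * A i j * \<beta> j) = (\<Sum>j\<in>Y. h i * A i j * \<beta> j)" for i
    using assms by (intro sum.mono_neutral_right) auto
  then show ?thesis
    unfolding pairing_def using assms by (auto intro!: sum.mono_neutral_right)
qed

text \<open>On vectors supported on Y, all terms of the pairing with an index outside Y vanish.
  Words of W(Y) can therefore be read in W.\<close>

lemma refl_subset: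
  assumes "finite X" "Y \<subseteq> X" "i \<in> Y"
  shows "(\<And>k. k \<notin> Y \<Longrightarrow> \<beta> k = 0) \<Longrightarrow> simple_refl X A i \<beta> = simple_refl Y A i \<beta>"
    and "(\<And>k. k \<notin> Y \<Longrightarrow> h k = 0) \<Longrightarrow> simple_corefl X A i h = simple_corefl Y A i h"
proof -
  have "simple_root i k = 0" "simple_coroot i k = 0" if "k \<notin> Y" for k
    using that assms(3) by (auto simp: simple_root_def simple_coroot_def)
  note pairing = pairing_subset[OF assms(1,2)] this
  show "simple_refl X A i \<beta> = simple_refl Y A i \<beta>" if "\<And>k. k \<notin> Y \<Longrightarrow> \<beta> k = 0"
    unfolding simple_refl_def by (simp add: pairing that)
  show "simple_corefl X A i h = simple_corefl Y A i h" if "\<And>k. k \<notin> Y \<Longrightarrow> h k = 0"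
    unfolding simple_corefl_def by (simp add: pairing that)
qed

lemma root_coroot_pair_subdiagram:
  assumes "root_coroot_pair Y A Y \<beta> h" "finite X" "Y \<subseteq> X"
  shows "root_coroot_pair X A Y \<beta> h"
  using assms(1)
proof induction
  case (simple p)
  then show ?case by (rule root_coroot_pair.simple)
next
  case (refl \<beta> h i)
  have "simple_refl X A i \<beta> = simple_refl Y A i \<beta>" "simple_corefl X A i h = simple_corefl Y A i h"
    using refl_subset[OF assms(2,3) refl.hyps(2)] root_coroot_pair_support[OF refl.hyps(1)] by auto
  then show ?case
    using root_coroot_pair.refl[OF refl.IH, of i] refl.hyps(2) assms(3) by auto
qed

text \<open>Symmetrizability makes the coroot independent of the word that produced the
  root.\<close>

lemma coroot_root_coroot_pair:
  assumes "generalized_cartan_matrix X A" "symmetrizable X A" "T \<subseteq> X"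
    and "root_coroot_pair X A T \<beta> h"
  shows "coroot X A \<beta> = h"
  using assms(4,1)
proof (rule root_coroot_pairE)
  fix w p
  assume "w \<in> weyl_group X A" "p \<in> T" "\<beta> = fst w (simple_root p)" "h = snd w (simple_coroot p)"
  then show ?thesis using coroot_eqI[OF assms(1,2)] assms(3) by auto
qed

section \<open>Reduction modulo d to the lattices of Y\<close>

text \<open>For (U, V) = (X, Y), \<open>dvd_A\<close> is condition (a), with i outside Y and j
  inside; for (Y, X) it is (b). A vertex outside Y lies in exactly one of U and V.\<close>

locale cartan_reduction =
  fixes X Y U V :: "'i set" and A :: "'i \<Rightarrow> 'i \<Rightarrow> int" and d :: int
  assumes finite_X: "finite X" and Un: "U \<union> V = X" and Int: "U \<inter> V = Y"
    and dvd_A: "\<And>i j. i \<in> U \<Longrightarrow> j \<in> V \<Longrightarrow> i \<notin> Y \<or> j \<notin> Y \<Longrightarrow> d dvd A i j"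
begin

text \<open>The relation is lopsided: \<open>\<beta>'\<close> is exactly supported on Y, while
  \<open>\<beta>\<close> is arbitrary outside Z. On vertices of Z outside Y, \<open>\<beta>\<close>
  is thus divisible by d.\<close>

definition reduces :: "'i set \<Rightarrow> ('i \<Rightarrow> int) \<Rightarrow> ('i \<Rightarrow> int) \<Rightarrow> bool" where
  "reduces Z \<beta> \<beta>' \<longleftrightarrow> (\<forall>k\<in>Z. [\<beta> k = \<beta>' k] (mod d)) \<and> (\<forall>k. k \<notin> Y \<longrightarrow> \<beta>' k = 0)"

text \<open>The comparison is termwise: where \<open>reduces\<close> leaves one coordinate free,
  either the matrix entry or the other coordinate is divisible by d.\<close>

lemma pairing_cong:
  assumes "reduces V h h'" "reduces U \<beta> \<beta>'"
  shows "[pairing X A h \<beta> = pairing X A h' \<beta>'] (mod d)"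
  unfolding pairing_def
proof (intro cong_sum)
  fix i j assume "i \<in> X" "j \<in> X"
  then consider "i \<in> V" "j \<in> U" | "i \<in> U" "j \<in> V" "i \<notin> Y \<or> j \<notin> Y"
    | "j \<in> U" "j \<notin> Y" "i \<notin> Y" | "i \<in> V" "i \<notin> Y" "j \<notin> Y"
    using Un Int by blast
  then show "[h i * A i j * \<beta> j = h' i * A i j * \<beta>' j] (mod d)"
  proof cases
    case 1
    then show ?thesis using assms by (intro cong_mult) (auto simp: reduces_def)
  next
    case 2
    then have "d dvd h i * A i j * \<beta> j" "d dvd h' i * A i j * \<beta>' j"
      using dvd_A by auto
    then show ?thesis by (simp only: cong_iff_dvd_diff dvd_diff)
  next
    case 3
    then have "d dvd \<beta> j" "\<beta>' j = 0" using assms by (force simp: cong_0_iff reduces_def)+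
    then show ?thesis by (simp add: cong_0_iff)
  next
    case 4
    then have "d dvd h i" "h' i = 0" using assms by (force simp: cong_0_iff reduces_def)+
    then show ?thesis by (simp add: cong_0_iff)
  qed
qed

lemma reduces_simple:
  assumes "p \<in> Y"
  shows "reduces Z (simple_root p) (simple_root p)" "reduces Z (simple_coroot p) (simple_coroot p)"
  using assms by (auto simp: reduces_def simple_root_def simple_coroot_def)

text \<open>Only coordinates in Z are compared, so a simple root or coroot outside Z counts as zero.
  Through \<open>pairing_cong\<close> this gives pairings divisible by d.\<close>

lemma reduces_simple_0:
  assumes "p \<notin> Z"
  shows "reduces Z (simple_root p) (\<lambda>_. 0)" "reduces Z (simple_coroot p) (\<lambda>_. 0)"
  using assms by (auto simp: reduces_def simple_root_def simple_coroot_def)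

text \<open>A letter in Y is kept: its simple root and coroot reduce to themselves, so the two
  reflection scalars are congruent.\<close>

lemma reduces_refl_inside:
  assumes "i \<in> Y"
  shows "reduces U \<beta> \<beta>' \<Longrightarrow> reduces U (simple_refl X A i \<beta>) (simple_refl X A i \<beta>')"
    and "reduces V h h' \<Longrightarrow> reduces V (simple_corefl X A i h) (simple_corefl X A i h')"
proof -
  have *: "simple_root i k = 0" "simple_coroot i k = 0" if "k \<notin> Y" for k
    using that assms by (auto simp: simple_root_def simple_coroot_def)
  show "reduces U (simple_refl X A i \<beta>) (simple_refl X A i \<beta>')" if r: "reduces U \<beta> \<beta>'"
    unfolding reduces_def simple_refl_def
  proof (intro conjI ballI allI impI cong_diff cong_mult cong_refl)
    show "[\<beta> k = \<beta>' k] (mod d)" if "k \<in> U" for k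
      using r that by (simp add: reduces_def)
    show "[pairing X A (simple_coroot i) \<beta> = pairing X A (simple_coroot i) \<beta>'] (mod d)"
      by (rule pairing_cong[OF reduces_simple(2)[OF assms] r])
    show "\<beta>' k - pairing X A (simple_coroot i) \<beta>' * simple_root i k = 0" if "k \<notin> Y" for k
      using r that by (simp add: reduces_def *)
  qed
  show "reduces V (simple_corefl X A i h) (simple_corefl X A i h')" if r: "reduces V h h'"
    unfolding reduces_def simple_corefl_def
  proof (intro conjI ballI allI impI cong_diff cong_mult cong_refl)
    show "[h k = h' k] (mod d)" if "k \<in> V" for k
      using r that by (simp add: reduces_def)
    show "[pairing X A h (simple_root i) = pairing X A h' (simple_root i)] (mod d)"
      by (rule pairing_cong[OF r reduces_simple(1)[OF assms]])
    show "h' k - pairing X A h' (simple_root i) * simple_coroot i k = 0" if "k \<notin> Y" for k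
      using r that by (simp add: reduces_def *)
  qed
qed

text \<open>A letter outside Y is deleted. If the compared set misses i, the changed coordinate is
  invisible; otherwise i is missing from the other set, and the reflection scalar is divisible by
  d.\<close>

lemma reduces_refl_outside:
  assumes "i \<in> X" "i \<notin> Y"
  shows "reduces U \<beta> \<beta>' \<Longrightarrow> reduces U (simple_refl X A i \<beta>) \<beta>'"
    and "reduces V h h' \<Longrightarrow> reduces V (simple_corefl X A i h) h'"
proof -
  have "[\<beta> k - pairing X A (simple_coroot i) \<beta> * simple_root i k = \<beta>' k - 0] (mod d)"
    if "reduces U \<beta> \<beta>'" "k \<in> U" for k
  proof (rule cong_diff)
    show "[\<beta> k = \<beta>' k] (mod d)" using that by (simp add: reduces_def)
    show "[pairing X A (simple_coroot i) \<beta> * simple_root i k = 0] (mod d)"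
    proof (cases "i = k")
      case True
      then have "i \<notin> V" using that(2) assms(2) Int by blast
      then have "[pairing X A (simple_coroot i) \<beta> = 0] (mod d)"
        using pairing_cong[OF reduces_simple_0(2) that(1)] by (simp add: pairing_def)
      then show ?thesis by (simp add: cong_0_iff)
    qed (simp add: simple_root_def)
  qed
  then show "reduces U (simple_refl X A i \<beta>) \<beta>'" if "reduces U \<beta> \<beta>'"
    using that by (simp add: reduces_def simple_refl_def)
  have "[h k - pairing X A h (simple_root i) * simple_coroot i k = h' k - 0] (mod d)"
    if "reduces V h h'" "k \<in> V" for k
  proof (rule cong_diff)
    show "[h k = h' k] (mod d)" using that by (simp add: reduces_def)
    show "[pairing X A h (simple_root i) * simple_coroot i k = 0] (mod d)"
    proof (cases "i = k")
      case True
      then have "i \<notin> U" using that(2) assms(2) Int by blast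
      then have "[pairing X A h (simple_root i) = 0] (mod d)"
        using pairing_cong[OF that(1) reduces_simple_0(1)] by (simp add: pairing_def)
      then show ?thesis by (simp add: cong_0_iff)
    qed (simp add: simple_coroot_def)
  qed
  then show "reduces V (simple_corefl X A i h) h'" if "reduces V h h'"
    using that by (simp add: reduces_def simple_corefl_def)
qed

lemma root_coroot_pair_reduces:
  assumes "root_coroot_pair X A Y \<beta> h"
  shows "\<exists>\<beta>' h'. root_coroot_pair Y A Y \<beta>' h' \<and> reduces U \<beta> \<beta>' \<and> reduces V h h'"
  using assms
proof induction
  case (simple p)
  show ?case
    using root_coroot_pair.simple[OF simple] reduces_simple(1)[OF simple, of U]
      reduces_simple(2)[OF simple, of V] by blast
next
  case (refl \<beta> h i)
  then obtain \<beta>' h' where r: "root_coroot_pair Y A Y \<beta>' h'" "reduces U \<beta> \<beta>'" "reduces V h h'"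
    by blast
  show ?case
  proof (cases "i \<in> Y")
    case True
    have "Y \<subseteq> X" using Un Int by blast
    \<comment> \<open>The witnesses must be pairs of the diagram Y, but the reduction reflects in X;
      both agree on vectors supported on Y.\<close>
    then have eq: "simple_refl X A i \<beta>' = simple_refl Y A i \<beta>'"
      "simple_corefl X A i h' = simple_corefl Y A i h'"
      using refl_subset[OF finite_X _ True] r(2,3) by (auto simp: reduces_def)
    show ?thesis
      using root_coroot_pair.refl[OF r(1) True] reduces_refl_inside(1)[OF True r(2)]
        reduces_refl_inside(2)[OF True r(3)]
      unfolding eq by blast
  next
    case False
    then show ?thesis
      using r(1) reduces_refl_outside(1)[OF refl.hyps(2) _ r(2)]
        reduces_refl_outside(2)[OF refl.hyps(2) _ r(3)] by blast
  qed
qed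

end

section \<open>Assembling the congruence of matrices\<close>

text \<open>Such an element is w v \<alpha>_p with v in W(Y); reading v in W makes it a single word
  applied to a simple root of Y.\<close>

lemma weyl_orbits_real_rootsE:
  assumes gcm: "generalized_cartan_matrix X A" and "Y \<subseteq> X"
    and "\<beta> \<in> weyl_orbits X A (real_roots Y A)"
  obtains h where "root_coroot_pair X A Y \<beta> h"
proof -
  obtain w v p where w: "w \<in> weyl_group X A" and v: "v \<in> weyl_group Y A" and p: "p \<in> Y"
    and \<beta>: "\<beta> = fst w (fst v (simple_root p))"
    using assms(3) unfolding weyl_orbits_def real_roots_def by blast
  have "root_coroot_pair Y A Y (fst v (simple_root p)) (snd v (simple_coroot p))"
    using root_coroot_pair_weyl[OF generalized_cartan_matrix_subset[OF gcm \<open>Y \<subseteq> X\<close>] v]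
      root_coroot_pair.simple[OF p] .
  then have "root_coroot_pair X A Y (fst v (simple_root p)) (snd v (simple_coroot p))"
    using root_coroot_pair_subdiagram finite_diagram[OF gcm] \<open>Y \<subseteq> X\<close> by blast
  then show thesis using root_coroot_pair_weyl[OF gcm w] that unfolding \<beta> by blast
qed

lemma root_coroot_pair_real_root:
  assumes "root_coroot_pair Y A Y \<beta> h" "generalized_cartan_matrix Y A"
  shows "\<beta> \<in> real_roots Y A"
proof (rule root_coroot_pairE[OF assms])
  fix w p
  assume "w \<in> weyl_group Y A" "p \<in> Y" "\<beta> = fst w (simple_root p)"
  then show ?thesis unfolding real_roots_def weyl_orbits_def by blast
qed

theorem theorem5p3:
  fixes X Y :: "'i set" and A :: "'i \<Rightarrow> 'i \<Rightarrow> int"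
    and d :: int and m :: nat and \<beta> :: "nat \<Rightarrow> 'i \<Rightarrow> int"
  assumes "generalized_cartan_matrix X A" and "symmetrizable X A"
    and "Y \<subseteq> X"
    and "d \<ge> 2"
    and "(\<forall>i\<in>Y. \<forall>j\<in>X - Y. d dvd pairing X A (simple_coroot j) (simple_root i)) \<or>
         (\<forall>i\<in>Y. \<forall>j\<in>X - Y. d dvd pairing X A (simple_coroot i) (simple_root j))"
    and "\<forall>i\<in>{1..m}. \<beta> i \<in> weyl_orbits X A (real_roots Y A)"
  shows "\<exists>\<beta>' :: nat \<Rightarrow> 'i \<Rightarrow> int.
           (\<forall>i\<in>{1..m}. \<beta>' i \<in> real_roots Y A) \<and>
           (\<forall>i\<in>{1..m}. \<forall>j\<in>{1..m}.
              [pairing_matrix X A \<beta> i j = pairing_matrix X A \<beta>' i j] (mod d))"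
proof -
  note gcm = assms(1) and sym = assms(2) and sub = assms(3)
  have fin: "finite X" using finite_diagram[OF gcm] .
  have "\<exists>U V. cartan_reduction X Y U V A d"
    using assms(5)
  proof
    assume a: "\<forall>i\<in>Y. \<forall>j\<in>X - Y. d dvd pairing X A (simple_coroot j) (simple_root i)"
    have "cartan_reduction X Y X Y A d"
    proof
      show "d dvd A i j" if "i \<in> X" "j \<in> Y" "i \<notin> Y \<or> j \<notin> Y" for i j
        using a[rule_format, of j i] that pairing_simple[OF fin, of i j A] sub by auto
    qed (use sub fin in auto)
    then show ?thesis by blast
  next
    assume b: "\<forall>i\<in>Y. \<forall>j\<in>X - Y. d dvd pairing X A (simple_coroot i) (simple_root j)"
    have "cartan_reduction X Y Y X A d"
    proof
      show "d dvd A i j" if "i \<in> Y" "j \<in> X" "i \<notin> Y \<or> j \<notin> Y" for i j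
        using b[rule_format, of i j] that pairing_simple[OF fin, of i j A] sub by auto
    qed (use sub fin in auto)
    then show ?thesis by blast
  qed
  then obtain U V where "cartan_reduction X Y U V A d" by blast
  then interpret cartan_reduction X Y U V A d .
  \<comment> \<open>Each index is reduced on its own, as \<open>pairing_cong\<close> compares any
    reduced coroot with any reduced root.\<close>
  have "\<exists>h \<beta>' h'. root_coroot_pair X A Y (\<beta> i) h \<and> root_coroot_pair Y A Y \<beta>' h' \<and>
          reduces U (\<beta> i) \<beta>' \<and> reduces V h h'" if i: "i \<in> {1..m}" for i
  proof -
    obtain h where "root_coroot_pair X A Y (\<beta> i) h"
      using weyl_orbits_real_rootsE[OF gcm sub bspec[OF assms(6) i]] .
    then show ?thesis using root_coroot_pair_reduces[of "\<beta> i" h] by blast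
  qed
  then obtain h \<beta>' h' where r: "\<And>i. i \<in> {1..m} \<Longrightarrow> root_coroot_pair X A Y (\<beta> i) (h i)"
      "\<And>i. i \<in> {1..m} \<Longrightarrow> root_coroot_pair Y A Y (\<beta>' i) (h' i)"
      "\<And>i. i \<in> {1..m} \<Longrightarrow> reduces U (\<beta> i) (\<beta>' i)"
      "\<And>i. i \<in> {1..m} \<Longrightarrow> reduces V (h i) (h' i)"
    by metis
  have "\<beta>' i \<in> real_roots Y A" if "i \<in> {1..m}" for i
    using root_coroot_pair_real_root[OF r(2)[OF that] generalized_cartan_matrix_subset[OF gcm sub]] .
  \<comment> \<open>Both matrices use coroots taken in X, so the pair of \<open>\<beta>'\<close> is
    carried from Y to X.\<close>
  moreover have "[pairing_matrix X A \<beta> i j = pairing_matrix X A \<beta>' i j] (mod d)"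
    if "i \<in> {1..m}" "j \<in> {1..m}" for i j
    using pairing_cong[OF r(4)[OF that(1)] r(3)[OF that(2)]]
    unfolding pairing_matrix_def coroot_root_coroot_pair[OF gcm sym sub r(1)[OF that(1)]]
      coroot_root_coroot_pair[OF gcm sym sub root_coroot_pair_subdiagram[OF r(2)[OF that(1)] fin sub]] .
  ultimately show ?thesis by blast
qed

end
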